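(* Let $X_1,\ldots,X_n\in\mathfrak{X}$ and $z\in\mathbb{R}^n$. Then $z\in\mathcal{Q}_{\mathcal{X}}$ if and only if for every $j=1,\ldots,n$ $$z^j=\inf\left\{\sum_{k=1}^n\theta^kz^k:\ \sum_{k=1}^n\theta^k=1,\ \vartheta+\sum_{k=1}^n\theta^kX_k=X_j,\ \theta\ge0,\ \theta\in\mathbb{R}^n,\ \vartheta\in\mathbb{R}^d_+\right\}.$$
   Context: $\mathfrak{X}\subset\mathbb{R}^d$ ($d\ge1$) is a closed convex set with nonempty interior, and $\mathcal{X}=\{X_1,\ldots,X_n\}\subset\mathfrak{X}$. $\mathcal{Q}_{\mathcal{X}}$ is the set of all $z=(z^1,\ldots,z^n)\in\mathbb{R}^n$ for which there is a convex, componentwise nonincreasing function $\psi:\mathfrak{X}\to\mathbb{R}$ with $\psi(X_j)=z^j$ for all $j=1,\ldots,n$; componentwise nonincreasing means $\psi(x)\ge\psi(y)$ whenever $x\le y$ componentwise. $\mathbb{R}^d_+$ is the nonnegative orthant of $\mathbb{R}^d$. Upper indices denote components of vectors. *)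

theory Defs
  imports "HOL-Analysis.Analysis"
begin

(* R^d and R^n are real^'d and real^'n with arbitrary finite (nonempty) index types, and
   the points X_1, ..., X_n form a family indexed by 'n (repetitions allowed). The order on
   real^'d is componentwise, so antimono_on is "componentwise nonincreasing". Functions are
   total in HOL; only the values of psi on S matter. *)

definition Q_set :: "(real^'d) set \<Rightarrow> ('n \<Rightarrow> real^'d) \<Rightarrow> (real^'n) set" where
  "Q_set S X = {z. \<exists>\<psi> :: real^'d \<Rightarrow> real.
      convex_on S \<psi> \<and> antimono_on S \<psi> \<and> (\<forall>j. \<psi> (X j) = z $ j)}"

end

theory Submission
  imports Defs
begin

text \<open>If no feasible combination for \<open>X j\<close> has value below \<open>z $ j\<close>, then by Farkas' lemma
  there is a nonincreasing affine function through \<open>(X j, z $ j)\<close> lying below all the data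
  points. The maximum of these functions over \<open>j\<close> interpolates the data; unlike the optimal
  value function of the linear program it is finite on the whole space. The converse is
  Jensen's inequality.\<close>

text \<open>A finitely generated cone is closed, so a hyperplane strictly separates \<open>y\<close>
  from it. As 0 lies in the cone, the level \<open>b\<close> is negative. A generator on the
  negative side could be stretched until it reaches that level, so all generators lie on the
  nonnegative side.\<close>

lemma farkas_cone_separation:
  fixes G :: "'a::euclidean_space set"
  assumes "finite G" and "y \<notin> convex_cone hull G"
  obtains a where "\<And>g. g \<in> G \<Longrightarrow> 0 \<le> a \<bullet> g" and "a \<bullet> y < 0"
proof -
  let ?K = "convex_cone hull G"
  obtain a b where "a \<bullet> y < b" and b: "\<And>x. x \<in> ?K \<Longrightarrow> b < a \<bullet> x"
    using separating_hyperplane_closed_point[of ?K y] assms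
    by (auto simp: convex_convex_cone_hull closed_convex_cone_hull)
  moreover have "b < 0"
    using b[of 0] by (simp add: convex_cone_hull_contains_0)
  moreover have "0 \<le> a \<bullet> g" if "g \<in> G" for g
  proof (rule ccontr)
    assume neg: "\<not> 0 \<le> a \<bullet> g"
    \<comment> \<open>The factor is a quotient of two negative numbers, and the stretched generator
      has value exactly \<open>b\<close> under \<open>a\<close>, against the strict bound
      \<open>b\<close>.\<close>
    have "(b / (a \<bullet> g)) *\<^sub>R g \<in> ?K"
      using that neg \<open>b < 0\<close> by (intro convex_cone_hull_mul hull_inc) (auto simp: divide_nonpos_neg)
    from b[OF this] neg show False
      by simp
  qed
  ultimately show thesis
    by (intro that[of a]) auto
qed

lemma inner_nonneg_cart:
  fixes x y :: "real^'d"
  assumes "0 \<le> x" and "0 \<le> y"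
  shows "0 \<le> x \<bullet> y"
  using assms by (auto simp: inner_vec_def less_eq_vec_def intro!: sum_nonneg)

text \<open>This is duality for the linear program at \<open>X j\<close>: \<open>opt\<close> says
  that the trivial combination is optimal, and \<open>q\<close> is a dual solution. The minorant is
  the function of x given by \<open>z $ j + q \<bullet> (X j - x)\<close>, with gradient
  \<open>- q\<close>.\<close>

lemma exists_nonincreasing_affine_minorant:
  fixes X :: "'n::finite \<Rightarrow> real^'d" and z :: "real^'n"
  assumes opt: "\<And>(\<theta> :: real^'n) \<eta>. (\<Sum>k\<in>UNIV. \<theta> $ k) = 1 \<Longrightarrow>
      \<eta> + (\<Sum>k\<in>UNIV. \<theta> $ k *\<^sub>R X k) = X j \<Longrightarrow> 0 \<le> \<theta> \<Longrightarrow> 0 \<le> \<eta> \<Longrightarrow>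
      z $ j \<le> (\<Sum>k\<in>UNIV. \<theta> $ k * z $ k)"
  obtains q where "0 \<le> q" and "\<And>k. z $ j + q \<bullet> (X j - X k) \<le> z $ k"
proof -
  \<comment> \<open>The data are translated so that \<open>(X j, z $ j)\<close> becomes the origin;
    the horizontal axis directions generate the slack vectors.\<close>
  define G :: "((real^'d) \<times> real) set" where
    "G = range (\<lambda>k. (X k - X j, z $ k - z $ j)) \<union> range (\<lambda>i. (axis i 1, 0))"
  \<comment> \<open>An explicit form of the cone over \<open>G\<close>, with the multiples of the
    axis vectors gathered into the single vector \<open>\<eta>\<close>. The hull lies inside it
    because \<open>C\<close> is a convex cone containing \<open>G\<close>.\<close>
  define C :: "((real^'d) \<times> real) set" where
    "C = {(\<eta> + (\<Sum>k\<in>UNIV. c $ k *\<^sub>R (X k - X j)), \<Sum>k\<in>UNIV. c $ k * (z $ k - z $ j)) |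
      (c :: real^'n) \<eta>. 0 \<le> c \<and> 0 \<le> \<eta>}"
  have CI: "p \<in> C" if "0 \<le> c" "0 \<le> \<eta>" "fst p = \<eta> + (\<Sum>k\<in>UNIV. c $ k *\<^sub>R (X k - X j))"
      "snd p = (\<Sum>k\<in>UNIV. c $ k * (z $ k - z $ j))" for p \<eta> and c :: "real^'n"
    unfolding C_def using that by (cases p) auto
  have "G \<subseteq> C"
  proof
    fix g assume "g \<in> G"
    then consider k where "g = (X k - X j, z $ k - z $ j)" | i where "g = (axis i 1, 0)"
      by (auto simp: G_def)
    then show "g \<in> C"
    proof cases
      case 1
      then show ?thesis
        by (intro CI[of "axis k 1" 0])
          (auto simp: less_eq_vec_def axis_def if_distrib[of "\<lambda>t. t *\<^sub>R _"]
            if_distrib[of "\<lambda>t. t * _"] cong: if_cong)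
    next
      case 2
      then show ?thesis
        by (intro CI[of 0 "axis i 1"]) (auto simp: less_eq_vec_def axis_def)
    qed
  qed
  moreover have "convex_cone C"
    unfolding convex_cone_iff
  proof (intro conjI ballI allI impI)
    show "0 \<in> C"
      by (intro CI[of 0 0]) auto
  next
    fix p p' assume "p \<in> C" "p' \<in> C"
    then obtain c \<eta> c' \<eta>' where
      "0 \<le> c" "0 \<le> \<eta>" "p = (\<eta> + (\<Sum>k\<in>UNIV. c $ k *\<^sub>R (X k - X j)), \<Sum>k\<in>UNIV. c $ k * (z $ k - z $ j))"
      "0 \<le> c'" "0 \<le> \<eta>'" "p' = (\<eta>' + (\<Sum>k\<in>UNIV. c' $ k *\<^sub>R (X k - X j)), \<Sum>k\<in>UNIV. c' $ k * (z $ k - z $ j))"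
      unfolding C_def by blast
    then show "p + p' \<in> C"
      by (intro CI[of "c + c'" "\<eta> + \<eta>'"])
        (simp_all add: less_eq_vec_def scaleR_add_left distrib_right sum.distrib)
  next
    fix p and r :: real assume "p \<in> C" "0 \<le> r"
    then obtain c \<eta> where
      "0 \<le> c" "0 \<le> \<eta>" "p = (\<eta> + (\<Sum>k\<in>UNIV. c $ k *\<^sub>R (X k - X j)), \<Sum>k\<in>UNIV. c $ k * (z $ k - z $ j))"
      unfolding C_def by blast
    with \<open>0 \<le> r\<close> show "r *\<^sub>R p \<in> C"
      by (intro CI[of "r *\<^sub>R c" "r *\<^sub>R \<eta>"])
        (simp_all add: less_eq_vec_def scaleR_add_right scaleR_sum_right sum_distrib_left mult.assoc)
  qed
  ultimately have "convex_cone hull G \<subseteq> C"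
    by (rule hull_minimal)
  \<comment> \<open>Suppose weights \<open>c\<close> with total \<open>s\<close> produced this
    point. If \<open>s = 0\<close>, all weights vanish and the second component is 0. Otherwise
    dividing by \<open>s\<close> gives a feasible combination for \<open>X j\<close> of value
    \<open>z $ j - 1 / s\<close>, against \<open>opt\<close>.\<close>
  moreover have "(0, -1) \<notin> C"
  proof
    assume "(0, -1) \<in> C"
    then obtain c :: "real^'n" and \<eta> where c: "0 \<le> c" and \<eta>: "0 \<le> \<eta>"
      and eq: "\<eta> + (\<Sum>k\<in>UNIV. c $ k *\<^sub>R (X k - X j)) = 0"
      and val: "(\<Sum>k\<in>UNIV. c $ k * (z $ k - z $ j)) = -1"
      unfolding C_def by auto
    define s where "s = (\<Sum>k\<in>UNIV. c $ k)"
    have c0: "0 \<le> c $ k" for k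
      using c by (simp add: less_eq_vec_def)
    have "s \<noteq> 0"
    proof
      assume "s = 0"
      then have "c $ k = 0" for k
        using c0 by (simp add: s_def sum_nonneg_eq_0_iff)
      with val show False
        by simp
    qed
    moreover have "0 \<le> s"
      unfolding s_def using c0 by (simp add: sum_nonneg)
    ultimately have s: "0 < s"
      by simp
    have "\<eta> + (\<Sum>k\<in>UNIV. c $ k *\<^sub>R X k) = s *\<^sub>R X j"
      using eq by (simp add: s_def scaleR_diff_right sum_subtractf scaleR_sum_left algebra_simps)
    then have "(1 / s) *\<^sub>R (\<eta> + (\<Sum>k\<in>UNIV. c $ k *\<^sub>R X k)) = X j"
      using s by simp
    then have "z $ j \<le> (\<Sum>k\<in>UNIV. ((1 / s) *\<^sub>R c) $ k * z $ k)"
      using s c0 \<eta>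
      by (intro opt[of _ "(1 / s) *\<^sub>R \<eta>"])
        (simp_all add: less_eq_vec_def scaleR_add_right scaleR_sum_right s_def flip: sum_divide_distrib)
    then have "s * z $ j \<le> (\<Sum>k\<in>UNIV. c $ k * z $ k)"
      using s by (simp add: field_simps flip: sum_divide_distrib)
    moreover have "(\<Sum>k\<in>UNIV. c $ k * z $ k) - s * z $ j = -1"
      using val by (simp add: s_def right_diff_distrib sum_subtractf sum_distrib_right)
    ultimately show False
      by simp
  qed
  moreover have "finite G"
    by (simp add: G_def)
  ultimately obtain a where a: "\<And>g. g \<in> G \<Longrightarrow> 0 \<le> a \<bullet> g" and "a \<bullet> (0, -1) < 0"
    using farkas_cone_separation[of G "(0, -1)"] by blast
  obtain p r where pr: "a = (p, r)"
    by (cases a)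
  \<comment> \<open>The separating hyperplane is not vertical, so dividing by \<open>r\<close> turns
    it into the graph of a function. The axis generators then give the sign of the slope, the data
    generators the bounds at the points \<open>X k\<close>.\<close>
  have r: "0 < r"
    using \<open>a \<bullet> (0, -1) < 0\<close> by (simp add: pr)
  show thesis
  proof (rule that[of "(1 / r) *\<^sub>R p"])
    have "0 \<le> p $ i" for i
      using a[of "(axis i 1, 0)"] by (simp add: G_def pr inner_axis)
    with r show "0 \<le> (1 / r) *\<^sub>R p"
      by (simp add: less_eq_vec_def)
  next
    fix k
    have "0 \<le> p \<bullet> (X k - X j) + r * (z $ k - z $ j)"
      using a[of "(X k - X j, z $ k - z $ j)"] by (simp add: G_def pr)
    then have "p \<bullet> (X j - X k) \<le> r * (z $ k - z $ j)"
      by (simp add: inner_diff_right)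
    then show "z $ j + ((1 / r) *\<^sub>R p) \<bullet> (X j - X k) \<le> z $ k"
      using r by (simp add: field_simps)
  qed
qed

lemma convex_on_Max:
  fixes f :: "'i::finite \<Rightarrow> 'a::real_vector \<Rightarrow> real"
  assumes "\<And>i. convex_on S (f i)"
  shows "convex_on S (\<lambda>x. Max (range (\<lambda>i. f i x)))"
proof (rule convex_onI)
  show "convex S"
    using assms convex_on_imp_convex by blast
next
  fix t :: real and x y
  assume t: "0 < t" "t < 1" and xy: "x \<in> S" "y \<in> S"
  show "Max (range (\<lambda>i. f i ((1 - t) *\<^sub>R x + t *\<^sub>R y)))
      \<le> (1 - t) * Max (range (\<lambda>i. f i x)) + t * Max (range (\<lambda>i. f i y))"
  proof (rule Max.boundedI)
    fix v assume "v \<in> range (\<lambda>i. f i ((1 - t) *\<^sub>R x + t *\<^sub>R y))"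
    then obtain i where "v = f i ((1 - t) *\<^sub>R x + t *\<^sub>R y)"
      by auto
    also have "\<dots> \<le> (1 - t) * f i x + t * f i y"
      using assms[of i] t xy by (intro convex_onD) auto
    also have "\<dots> \<le> (1 - t) * Max (range (\<lambda>i. f i x)) + t * Max (range (\<lambda>i. f i y))"
      using t by (intro add_mono mult_left_mono Max_ge) auto
    finally show "v \<le> \<dots>" .
  qed auto
qed

text \<open>Monotonicity absorbs the slack \<open>\<eta>\<close> and Jensen's inequality the
  weights; convexity of \<open>S\<close> puts the intermediate point \<open>?x\<close> into the
  domain where both apply.\<close>

lemma Q_set_ge:
  fixes X :: "'n::finite \<Rightarrow> real^'d" and \<theta> :: "real^'n"
  assumes "z \<in> Q_set S X" and X: "\<And>j. X j \<in> S"
    and \<theta>: "(\<Sum>k\<in>UNIV. \<theta> $ k) = 1" "0 \<le> \<theta>"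
    and \<eta>: "\<eta> + (\<Sum>k\<in>UNIV. \<theta> $ k *\<^sub>R X k) = X j" "0 \<le> \<eta>"
  shows "z $ j \<le> (\<Sum>k\<in>UNIV. \<theta> $ k * z $ k)"
proof -
  obtain \<psi> where \<psi>: "convex_on S \<psi>" "antimono_on S \<psi>" "\<And>j. \<psi> (X j) = z $ j"
    using assms(1) by (auto simp: Q_set_def)
  let ?x = "\<Sum>k\<in>UNIV. \<theta> $ k *\<^sub>R X k"
  have \<theta>0: "0 \<le> \<theta> $ k" for k
    using \<theta>(2) by (simp add: less_eq_vec_def)
  have "?x \<in> S"
    using convex_on_imp_convex[OF \<psi>(1)] \<theta>(1) \<theta>0 X by (intro convex_sum) auto
  moreover have "?x \<le> X j"
    by (metis \<eta> le_add_same_cancel2)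
  ultimately have "\<psi> (X j) \<le> \<psi> ?x"
    using \<psi>(2) X by (auto simp: monotone_on_def)
  also have "\<dots> \<le> (\<Sum>k\<in>UNIV. \<theta> $ k * \<psi> (X k))"
    using \<theta>(1) \<theta>0 X \<psi>(1) by (intro convex_on_sum) auto
  finally show ?thesis
    by (simp add: \<psi>(3))
qed

lemma Q_setI:
  fixes X :: "'n::finite \<Rightarrow> real^'d"
  assumes "convex S" and q: "\<And>j. 0 \<le> q j"
    and below: "\<And>j k. z $ j + q j \<bullet> (X j - X k) \<le> z $ k"
  shows "z \<in> Q_set S X"
proof -
  define f where "f j x = z $ j + q j \<bullet> (X j - x)" for j x
  define \<psi> where "\<psi> x = Max (range (\<lambda>j. f j x))" for x
  have "convex_on S (f j)" for j
  proof (rule convex_onI)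
    fix t :: real and x y
    show "f j ((1 - t) *\<^sub>R x + t *\<^sub>R y) \<le> (1 - t) * f j x + t * f j y"
      by (simp add: f_def inner_diff_right inner_add_right algebra_simps)
  qed (fact assms(1))
  then have "convex_on S \<psi>"
    unfolding \<psi>_def by (rule convex_on_Max)
  moreover have "antimono_on S \<psi>"
  proof (rule monotone_onI)
    fix x y :: "real^'d" assume "x \<le> y"
    \<comment> \<open>The difference \<open>f j x - f j y\<close> is
      \<open>q j \<bullet> (y - x)\<close>, a product of two nonnegative vectors.\<close>
    have "f j y \<le> f j x" for j
      using inner_nonneg_cart[OF q, of "y - x" j] \<open>x \<le> y\<close>
      by (simp add: f_def inner_diff_right)
    then have "f j y \<le> \<psi> x" for j
      unfolding \<psi>_def by (meson Max_ge finite finite_imageI order_trans rangeI)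
    then show "\<psi> y \<le> \<psi> x"
      unfolding \<psi>_def[of y] by (intro Max.boundedI) auto
  qed
  moreover have "\<psi> (X k) = z $ k" for k
    unfolding \<psi>_def
  \<comment> \<open>At \<open>X k\<close> the piece \<open>f k\<close> takes the value
    \<open>z $ k\<close>, and \<open>below\<close> keeps every other piece under it.\<close>
  proof (rule Max_eqI)
    show "z $ k \<in> range (\<lambda>j. f j (X k))"
      by (rule range_eqI[of _ _ k]) (simp add: f_def)
  qed (use below in \<open>auto simp: f_def\<close>)
  ultimately show ?thesis
    unfolding Q_set_def by blast
qed

theorem lemma2p6:
  fixes S :: "(real^'d) set" and X :: "'n::finite \<Rightarrow> real^'d" and z :: "real^'n"
  assumes "closed S" and "convex S" and "interior S \<noteq> {}"
    and "\<And>j. X j \<in> S"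
  shows "z \<in> Q_set S X \<longleftrightarrow>
    (\<forall>j. z $ j = Inf {(\<Sum>k\<in>UNIV. \<theta> $ k * z $ k) | (\<theta> :: real^'n) (\<eta> :: real^'d).
      (\<Sum>k\<in>UNIV. \<theta> $ k) = 1 \<and> \<eta> + (\<Sum>k\<in>UNIV. \<theta> $ k *\<^sub>R X k) = X j \<and>
      0 \<le> \<theta> \<and> 0 \<le> \<eta>})"
    (is "_ \<longleftrightarrow> (\<forall>j. z $ j = Inf (?V j))")
proof
  assume z: "z \<in> Q_set S X"
  show "\<forall>j. z $ j = Inf (?V j)"
  proof
    fix j
    \<comment> \<open>All weight on \<open>X j\<close> and no slack: the infimum is attained, hence
      a minimum.\<close>
    have "z $ j \<in> ?V j"
      by (rule CollectI, rule exI[of _ "axis j 1"], rule exI[of _ 0])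
        (auto simp: less_eq_vec_def axis_def if_distrib[of "\<lambda>t. t *\<^sub>R _"]
          if_distrib[of "\<lambda>t. t * _"] cong: if_cong)
    moreover have "z $ j \<le> v" if "v \<in> ?V j" for v
      using that Q_set_ge[OF z assms(4)] by blast
    ultimately show "z $ j = Inf (?V j)"
      by (intro cInf_eq_minimum[symmetric]) auto
  qed
next
  assume inf: "\<forall>j. z $ j = Inf (?V j)"
  \<comment> \<open>Without this bound, \<open>Inf (?V j)\<close> would be an unspecified real number.\<close>
  have bdd: "bdd_below (?V j)" for j
  proof (rule bdd_belowI[of _ "Min (range (($) z))"])
    fix v assume "v \<in> ?V j"
    then obtain \<theta> :: "real^'n" where v: "v = (\<Sum>k\<in>UNIV. \<theta> $ k * z $ k)"
      and \<theta>: "(\<Sum>k\<in>UNIV. \<theta> $ k) = 1" "0 \<le> \<theta>"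
      by blast
    \<comment> \<open>Weights of total 1 write the minimum as its own average, which compares with
      \<open>v\<close> term by term.\<close>
    have "Min (range (($) z)) = (\<Sum>k\<in>UNIV. \<theta> $ k * Min (range (($) z)))"
      using \<theta>(1) by (simp flip: sum_distrib_right)
    also have "\<dots> \<le> v"
      unfolding v using \<theta>(2) by (intro sum_mono mult_left_mono) (auto simp: less_eq_vec_def)
    finally show "Min (range (($) z)) \<le> v" .
  qed
  have "\<exists>q. 0 \<le> q \<and> (\<forall>k. z $ j + q \<bullet> (X j - X k) \<le> z $ k)" for j
  proof -
    have "z $ j \<le> (\<Sum>k\<in>UNIV. \<theta> $ k * z $ k)"
      if "(\<Sum>k\<in>UNIV. \<theta> $ k) = 1" "\<eta> + (\<Sum>k\<in>UNIV. \<theta> $ k *\<^sub>R X k) = X j" "0 \<le> \<theta>" "0 \<le> \<eta>"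
      for \<theta> :: "real^'n" and \<eta>
    proof -
      have "Inf (?V j) \<le> (\<Sum>k\<in>UNIV. \<theta> $ k * z $ k)"
        using that by (intro cInf_lower bdd) blast
      with inf show ?thesis
        by metis
    qed
    then show ?thesis
      by (rule exists_nonincreasing_affine_minorant[of X j z]) blast+
  qed
  then obtain q where "\<And>j. 0 \<le> q j" "\<And>j k. z $ j + q j \<bullet> (X j - X k) \<le> z $ k"
    by metis
  with \<open>convex S\<close> show "z \<in> Q_set S X"
    by (rule Q_setI)
qed

end
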